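(* Assume that $\nabla E$ is $L$-Lipschitz. Let $\varepsilon_k,\rho_k>0$, $\kappa\in(0,1)$ and $\theta\ge0$, let $u_+^k\in U$ be the fine-grid pre-iterate and $d^k\in U$ the coarse correction direction. If $$\Psi^k(u_+^k+\theta d^k)+\frac12\|\theta d^k\|_{M+\Lambda}^2+\frac1{2\varepsilon_k}\|\theta d^k\|_W^2\le\Psi^k(u_+^k)+\kappa\theta[\Psi^k]'(u_+^k;d^k)+\frac{\rho_k}2,$$ then $$\Phi^k(u_+^k+\theta d^k)+\frac12\|\theta d^k\|_M^2+\frac1{2\varepsilon_k}\|\theta d^k\|_W^2\le\Phi^k(u_+^k)+\kappa\theta[\Phi^k]'(u_+^k;d^k)+\frac{\rho_k}2.$$
   Context: $\mathbb L(A;B)$ denotes the bounded linear operators from $A$ to $B$; $\overline{\mathbb R}=[-\infty,+\infty]$; $\partial$ is the convex subdifferential, $(\cdot)^*$ on functions is the Fenchel conjugate and on operators the adjoint; $f'(u;d)$ is the (one-sided) directional derivative; $\|u\|_A:=\sqrt{\langle Au,u\rangle}$ for self-adjoint positive semi-definite $A$. Standing fine setting: $X,Y$ are Hilbert spaces, $U=X\times Y$; $F,E:X\to\overline{\mathbb R}$ and $G:Y\to\overline{\mathbb R}$ are proper, convex and lower semicontinuous, $E$ is differentiable on $X$ with $L$-Lipschitz gradient, $K\in\mathbb L(X;Y)$, and $\tau,\sigma>0$ satisfy $\tau L+\tau\sigma\|K\|^2<1$. For $u=(x,y)\in U$: $\bar G(u):=F(x)+G^*(y)$, $\bar E(u):=E(x)$,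 $$M=\begin{pmatrix}\tau^{-1}\mathrm{Id}&-K^*\\-K&\sigma^{-1}\mathrm{Id}\end{pmatrix},\ \Xi=\begin{pmatrix}0&K^*\\-K&0\end{pmatrix},\ \Lambda=\begin{pmatrix}L\,\mathrm{Id}&0\\0&0\end{pmatrix},\ Z=\begin{pmatrix}\tau^{-1}\mathrm{Id}&-2K^*\\0&\sigma^{-1}\mathrm{Id}\end{pmatrix},\ W=\frac1CZZ^*,$$ with $C:=(1-\sqrt{\tau\sigma}\|K\|)\min\{\tau^{-1},\sigma^{-1}\}>0$. Fine pre-iterate: given $u^k=(x^k,y^k)\in U$, $u_+^k=(x_+^k,y_+^k)$ with $x_+^k:=\mathrm{prox}_{\tau F}(x^k-\tau(\nabla E(x^k)+K^*y^k))$, $y_+^k:=\mathrm{prox}_{\sigma G^*}(y^k+\sigma K(2x_+^k-x^k))$. Set $$\Phi^k(u):=\bar G(u)+\bar E(u)+\langle\Xi u_+^k,u\rangle,\qquad \Psi^k(u):=\bar G(u)+\bar E(u_+^k)+\langle\nabla\bar E(u_+^k),u-u_+^k\rangle+\langle\Xi u_+^k,u\rangle.$$ Coarse direction: $X_H,Y_H$ are Hilbert spaces, $U_H=X_H\times Y_H$ with elements $v=(\zeta,\xi)$; $P_h^H\in\mathbb L(X;X_H)$, $D_h^H\in\mathbb L(Y;Y_H)$, $I_h^H(x,y):=(P_h^Hx,D_h^Hy)$, $I_H^h:=(I_h^H)^*$. $E_H:X_H\to\mathbb R$, $F_H^k:X_H\to\overline{\mathbb R}$, $G_H^k:Y_H\to\overline{\mathbb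 R}$ are proper, convex and lower semicontinuous, $E_H$ is differentiable with $L_H$-Lipschitz gradient, $K_H\in\mathbb L(X_H;Y_H)$, and $\tau_H,\sigma_H>0$ satisfy $\tau_HL_H+\tau_H\sigma_H\|K_H\|^2<1$. Write $\bar G_H^k(v):=F_H^k(\zeta)+(G_H^k)^*(\xi)$, $\bar E_H(v):=E_H(\zeta)$, $$M_H=\begin{pmatrix}\tau_H^{-1}\mathrm{Id}&-K_H^*\\-K_H&\sigma_H^{-1}\mathrm{Id}\end{pmatrix},\quad \Xi_H=\begin{pmatrix}0&K_H^*\\-K_H&0\end{pmatrix},$$ and let $v^{k,0}=I_h^Hu_+^k$ satisfy $I_h^H\partial\bar G(u_+^k)\subset\partial\bar G_H^k(v^{k,0})$. With $s_H^k:=I_h^H(\nabla\bar E(u_+^k)+\Xi u_+^k)-\nabla\bar E_H(v^{k,0})$, $m\ge1$ and $\vartheta\in\{0,1\}$, for $j=0,\ldots,m-1$ the iterate $v^{k,j+1}$ is determined by $$0\in\partial\bar G_H^k(v^{k,j+1})+\Xi_H(v^{k,j+1}-v_\vartheta^j)+\nabla\bar E_H(v^{k,j})+s_H^k+M_H(v^{k,j+1}-v^{k,j}),\quad v_\vartheta^j:=(1-\vartheta)v^{k,j}+\vartheta v^{k,0}.$$ Let $\tilde v^{k,m}:=\frac1m\sum_{j=0}^{m-1}v^{k,j+1}$ if $\vartheta=1$, $\tilde v^{k,m}:=v^{k,m}$ if $\vartheta=0$, and $d^k:=I_H^h(\tilde v^{k,m}-v^{k,0})$. *)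

theory Defs
  imports "HOL-Analysis.Analysis"
begin

text \<open>
  Real Hilbert spaces are types of sort \<open>{real_inner, complete_space}\<close>; on products, the library
  inner product is the sum of the inner products of the components. Bounded linear operators
  are elements of \<open>'a \<Rightarrow>\<^sub>L 'b\<close>, whose norm is the operator norm. The library constant \<open>adjoint\<close> is
  the Hilbert space adjoint, which exists for bounded operators because the spaces are complete.
\<close>

text \<open>
  In \<open>convex_ereal\<close> the value \<open>\<infinity> + -\<infinity> = \<infinity>\<close> of \<^typ>\<open>ereal\<close> is harmless: the predicate is only used
  together with \<open>proper\<close>.
\<close>

definition proper :: "('a \<Rightarrow> ereal) \<Rightarrow> bool" where
  "proper f \<longleftrightarrow> (\<forall>x. f x \<noteq> -\<infinity>) \<and> (\<exists>x. f x \<noteq> \<infinity>)"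

definition convex_ereal :: "('a::real_vector \<Rightarrow> ereal) \<Rightarrow> bool" where
  "convex_ereal f \<longleftrightarrow>
     (\<forall>x y. \<forall>t\<in>{0<..<1::real}.
        f ((1 - t) *\<^sub>R x + t *\<^sub>R y) \<le> ereal (1 - t) * f x + ereal t * f y)"

definition lsc :: "('a::topological_space \<Rightarrow> ereal) \<Rightarrow> bool" where
  "lsc f \<longleftrightarrow> (\<forall>x. f x \<le> Liminf (at x) f)"

definition proper_convex_lsc :: "('a::real_normed_vector \<Rightarrow> ereal) \<Rightarrow> bool" where
  "proper_convex_lsc f \<longleftrightarrow> proper f \<and> convex_ereal f \<and> lsc f"

definition fenchel_conjugate :: "('a::real_inner \<Rightarrow> ereal) \<Rightarrow> 'a \<Rightarrow> ereal" where
  "fenchel_conjugate f y = (SUP x. ereal (y \<bullet> x) - f x)"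

definition subdifferential :: "('a::real_inner \<Rightarrow> ereal) \<Rightarrow> 'a \<Rightarrow> 'a set" where
  "subdifferential f x = {p. \<forall>z. f x + ereal (p \<bullet> (z - x)) \<le> f z}"

definition prox :: "('a::real_inner \<Rightarrow> ereal) \<Rightarrow> 'a \<Rightarrow> 'a" where
  "prox f x = (ARG_MIN (\<lambda>z. f z + ereal ((norm (z - x))\<^sup>2 / 2)) z. True)"

definition dir_deriv :: "('a::real_normed_vector \<Rightarrow> ereal) \<Rightarrow> 'a \<Rightarrow> 'a \<Rightarrow> ereal" where
  "dir_deriv f u d = Lim (at_right 0) (\<lambda>t::real. (f (u + t *\<^sub>R d) - f u) / ereal t)"

definition grad :: "('a::real_inner \<Rightarrow> real) \<Rightarrow> 'a \<Rightarrow> 'a" where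
  "grad f x = (THE g. GDERIV f x :> g)"

definition op_norm :: "('a::real_inner \<Rightarrow> 'a) \<Rightarrow> 'a \<Rightarrow> real" where
  "op_norm A u = sqrt (A u \<bullet> u)"

text \<open>
  The functions below serve both the fine grid and the coarse grid. A smooth function is
  real-valued: differentiability on the whole space excludes infinite values.
\<close>

definition Gbar ::
  "('x \<Rightarrow> ereal) \<Rightarrow> ('y::real_inner \<Rightarrow> ereal) \<Rightarrow> 'x \<times> 'y \<Rightarrow> ereal" where
  "Gbar F G = (\<lambda>(x, y). F x + fenchel_conjugate G y)"

definition Ebar :: "('x \<Rightarrow> real) \<Rightarrow> 'x \<times> 'y \<Rightarrow> real" where
  "Ebar E = (\<lambda>(x, y). E x)"

definition op_M ::
  "real \<Rightarrow> real \<Rightarrow> ('x::real_inner \<Rightarrow>\<^sub>L 'y::real_inner) \<Rightarrow> 'x \<times> 'y \<Rightarrow> 'x \<times> 'y" where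
  "op_M \<tau> \<sigma> K = (\<lambda>(x, y).
     ((1 / \<tau>) *\<^sub>R x - adjoint (blinfun_apply K) y,
      - blinfun_apply K x + (1 / \<sigma>) *\<^sub>R y))"

definition op_Xi :: "('x::real_inner \<Rightarrow>\<^sub>L 'y::real_inner) \<Rightarrow> 'x \<times> 'y \<Rightarrow> 'x \<times> 'y" where
  "op_Xi K = (\<lambda>(x, y). (adjoint (blinfun_apply K) y, - blinfun_apply K x))"

definition op_Lambda :: "real \<Rightarrow> 'x::real_inner \<times> 'y::real_inner \<Rightarrow> 'x \<times> 'y" where
  "op_Lambda L = (\<lambda>(x, y). (L *\<^sub>R x, 0))"

definition op_Z ::
  "real \<Rightarrow> real \<Rightarrow> ('x::real_inner \<Rightarrow>\<^sub>L 'y::real_inner) \<Rightarrow> 'x \<times> 'y \<Rightarrow> 'x \<times> 'y" where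
  "op_Z \<tau> \<sigma> K = (\<lambda>(x, y).
     ((1 / \<tau>) *\<^sub>R x - 2 *\<^sub>R adjoint (blinfun_apply K) y, (1 / \<sigma>) *\<^sub>R y))"

definition const_C ::
  "real \<Rightarrow> real \<Rightarrow> ('x::real_inner \<Rightarrow>\<^sub>L 'y::real_inner) \<Rightarrow> real" where
  "const_C \<tau> \<sigma> K = (1 - sqrt (\<tau> * \<sigma>) * norm K) * min (1 / \<tau>) (1 / \<sigma>)"

definition op_W ::
  "real \<Rightarrow> real \<Rightarrow> ('x::real_inner \<Rightarrow>\<^sub>L 'y::real_inner) \<Rightarrow> 'x \<times> 'y \<Rightarrow> 'x \<times> 'y" where
  "op_W \<tau> \<sigma> K u = (1 / const_C \<tau> \<sigma> K) *\<^sub>R op_Z \<tau> \<sigma> K (adjoint (op_Z \<tau> \<sigma> K) u)"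

definition pre_iterate ::
  "real \<Rightarrow> real \<Rightarrow> ('x::real_inner \<Rightarrow> ereal) \<Rightarrow> ('y::real_inner \<Rightarrow> ereal) \<Rightarrow> ('x \<Rightarrow> real) \<Rightarrow>
   ('x \<Rightarrow>\<^sub>L 'y) \<Rightarrow> 'x \<times> 'y \<Rightarrow> 'x \<times> 'y" where
  "pre_iterate \<tau> \<sigma> F G E K = (\<lambda>(x, y).
     let xp = prox (\<lambda>z. ereal \<tau> * F z)
                (x - \<tau> *\<^sub>R (grad E x + adjoint (blinfun_apply K) y));
         yp = prox (\<lambda>z. ereal \<sigma> * fenchel_conjugate G z)
                (y + \<sigma> *\<^sub>R blinfun_apply K (2 *\<^sub>R xp - x))
     in (xp, yp))"

definition Phi ::
  "('x::real_inner \<Rightarrow> ereal) \<Rightarrow> ('y::real_inner \<Rightarrow> ereal) \<Rightarrow> ('x \<Rightarrow> real) \<Rightarrow> ('x \<Rightarrow>\<^sub>L 'y) \<Rightarrow>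
   'x \<times> 'y \<Rightarrow> 'x \<times> 'y \<Rightarrow> ereal" where
  "Phi F G E K up u = Gbar F G u + ereal (Ebar E u) + ereal (op_Xi K up \<bullet> u)"

definition Psi ::
  "('x::real_inner \<Rightarrow> ereal) \<Rightarrow> ('y::real_inner \<Rightarrow> ereal) \<Rightarrow> ('x \<Rightarrow> real) \<Rightarrow> ('x \<Rightarrow>\<^sub>L 'y) \<Rightarrow>
   'x \<times> 'y \<Rightarrow> 'x \<times> 'y \<Rightarrow> ereal" where
  "Psi F G E K up u = Gbar F G u + ereal (Ebar E up) + ereal (grad (Ebar E) up \<bullet> (u - up))
     + ereal (op_Xi K up \<bullet> u)"

definition restriction ::
  "('x::real_normed_vector \<Rightarrow>\<^sub>L 'p::real_normed_vector) \<Rightarrow>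
   ('y::real_normed_vector \<Rightarrow>\<^sub>L 'q::real_normed_vector) \<Rightarrow> 'x \<times> 'y \<Rightarrow> 'p \<times> 'q" where
  "restriction P D = (\<lambda>(x, y). (blinfun_apply P x, blinfun_apply D y))"

end

theory Submission
  imports Defs
begin

text \<open>
  The functions \<open>\<Phi>\<close> and \<open>\<Psi>\<close> share the nonsmooth part and the linear term \<open>\<langle>\<Xi> u\<^sub>+, \<cdot>\<rangle>\<close>; \<open>\<Psi>\<close> merely
  replaces the smooth part \<open>Ebar E\<close> by its linearisation at \<open>u\<^sub>+\<close>. Three consequences give the theorem.

  First, the two functions agree at \<open>u\<^sub>+\<close>. Second, they have the same directional derivative there:
  for a finite base value the difference quotients differ by a real function that tends to \<open>0\<close>,
  which affects neither the existence nor the value of a limit in the extended reals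
  (\<open>dir_deriv_Phi_eq_Psi\<close>). So the right-hand sides of the two descent inequalities coincide. Third,
  the descent lemma for the \<open>L\<close>-Lipschitz gradient of \<open>E\<close> (\<open>lipschitz_gradient_descent\<close>) bounds the
  linearisation error, \<open>\<Phi>(u\<^sub>+ + w) \<le> \<Psi>(u\<^sub>+ + w) + L/2 \<cdot> \<parallel>w\<^sub>x\<parallel>\<^sup>2\<close> (\<open>Phi_le_Psi_plus_quadratic\<close>), and the
  excess is exactly the \<open>\<Lambda>\<close> part of \<open>1/2 \<cdot> \<parallel>w\<parallel>\<^bsub>M+\<Lambda>\<^esub>\<^sup>2\<close>. If the nonsmooth part is infinite at \<open>u\<^sub>+\<close>, the
  right-hand side of the conclusion is \<open>\<infinity>\<close>.

  That \<open>\<parallel>\<cdot>\<parallel>\<^bsub>M+\<Lambda>\<^esub>\<^sup>2\<close> splits into a sum uses positivity of \<open>M\<close>: the square of \<open>op_norm\<close> is the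
  absolute value of the quadratic form, which is additive only where the form is nonnegative;
  positivity in turn needs the adjoint of \<open>K\<close> to satisfy its defining identity. This, and the
  representation of Frechet derivatives by gradients, rests on the Riesz representation theorem,
  which is proved here by minimising \<open>\<parallel>x\<parallel>\<^sup>2 - 2 f x\<close>.
\<close>

section \<open>Riesz representation and adjoints\<close>

text \<open>
  The representing vector is the minimiser of the strictly convex functional \<open>q x = \<parallel>x\<parallel>\<^sup>2 - 2 f x\<close>:
  by the parallelogram law a minimising sequence is Cauchy, and the first-order condition at its
  limit is the claimed identity.
\<close>

lemma riesz_representation:
  fixes f :: "'a::{real_inner,complete_space} \<Rightarrow> real"
  assumes "bounded_linear f"
  obtains z where "\<And>x. f x = x \<bullet> z"
proof -
  interpret f: bounded_linear f by fact
  define q where "q x = (norm x)\<^sup>2 - 2 * f x" for x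
  define I where "I = (INF x. q x)"
  obtain B where B: "\<And>x. norm (f x) \<le> norm x * B"
    using f.bounded by blast
  have q_ge: "q x \<ge> - B\<^sup>2" for x
  proof -
    have "0 \<le> (norm x - B)\<^sup>2" by simp
    also have "\<dots> = (norm x)\<^sup>2 - 2 * (norm x * B) + B\<^sup>2"
      by (simp add: power2_eq_square algebra_simps)
    finally show ?thesis
      using B[of x] by (simp add: q_def)
  qed
  have bdd: "bdd_below (range q)"
    using q_ge by (auto intro!: bdd_belowI[where m = "- B\<^sup>2"])
  have I_le: "I \<le> q x" for x
    unfolding I_def using bdd by (simp add: cINF_lower)
  have "\<exists>x. q x < I + 1 / Suc n" for n :: nat
  proof -
    have "(INF x. q x) < I + 1 / Suc n" by (simp add: I_def)
    then show ?thesis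
      using cINF_less_iff[OF _ bdd] by auto
  qed
  then obtain X where X: "\<And>n. q (X n) < I + 1 / Suc n" by metis
  have para: "(norm (a - b))\<^sup>2 \<le> 2 * (q a - I) + 2 * (q b - I)" for a b
  proof -
    have "q ((1/2) *\<^sub>R (a + b)) = (q a + q b) / 2 - (norm (a - b))\<^sup>2 / 4"
      by (simp add: q_def f.scaleR f.add power2_norm_eq_inner inner_add inner_diff
          inner_commute field_simps)
    then show ?thesis
      using I_le[of "(1/2) *\<^sub>R (a + b)"] by argo
  qed
  have "Cauchy X"
  proof (rule metric_CauchyI)
    fix e :: real
    assume "e > 0"
    then obtain N :: nat where N: "inverse (Suc N) < e\<^sup>2 / 4"
      using reals_Archimedean[of "e\<^sup>2 / 4"] by auto
    have "dist (X i) (X j) < e" if "i \<ge> N" "j \<ge> N" for i j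
    proof -
      have small: "q (X k) - I < e\<^sup>2 / 4" if "k \<ge> N" for k
      proof -
        have "inverse (real (Suc k)) \<le> inverse (Suc N)"
          using that by (intro le_imp_inverse_le) auto
        then show ?thesis using X[of k] N by (simp add: inverse_eq_divide)
      qed
      have "(norm (X i - X j))\<^sup>2 < e\<^sup>2"
        using para[of "X i" "X j"] small[OF \<open>i \<ge> N\<close>] small[OF \<open>j \<ge> N\<close>] by argo
      then show ?thesis
        using \<open>e > 0\<close> by (simp add: dist_norm power_less_imp_less_base)
    qed
    then show "\<exists>N. \<forall>i\<ge>N. \<forall>j\<ge>N. dist (X i) (X j) < e" by blast
  qed
  then obtain z where z: "X \<longlonglongrightarrow> z"
    using Cauchy_convergent convergent_def by blast
  have "(\<lambda>n. q (X n)) \<longlonglongrightarrow> q z"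
    unfolding q_def by (intro tendsto_intros f.tendsto z)
  moreover have "(\<lambda>n. I + 1 / Suc n) \<longlonglongrightarrow> I + 0"
    using LIMSEQ_inverse_real_of_nat by (intro tendsto_intros) (simp add: inverse_eq_divide)
  ultimately have "q z \<le> I + 0"
    by (rule LIMSEQ_le) (use X less_imp_le in blast)
  then have min: "q z \<le> q x" for x
    using I_le[of x] by simp
  have "f h = h \<bullet> z" for h
  proof (rule ccontr)
    \<comment> \<open>\<open>2 c\<close> is the slope of \<open>q\<close> at \<open>z\<close> in the direction \<open>h\<close>; the step \<open>- c / s\<close> is slightly shorter than
      the optimal one, \<open>- c / \<parallel>h\<parallel>\<^sup>2\<close>, so that the denominator is positive\<close>
    define c where "c = h \<bullet> z - f h"
    define s where "s = (norm h)\<^sup>2 + 1"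
    have s: "s > 0" by (simp add: s_def add_nonneg_pos)
    assume "f h \<noteq> h \<bullet> z"
    then have c: "c \<noteq> 0" by (simp add: c_def)
    have expand: "q (z + t *\<^sub>R h) = q z + t\<^sup>2 * (norm h)\<^sup>2 + 2 * t * c" for t
    proof -
      have "(norm (z + t *\<^sub>R h))\<^sup>2 = (norm z)\<^sup>2 + t\<^sup>2 * (norm h)\<^sup>2 + 2 * t * (h \<bullet> z)"
        by (simp only: power2_norm_eq_inner inner_add inner_scaleR_left inner_scaleR_right
            inner_commute[of h z]) (simp add: power2_eq_square algebra_simps)
      then show ?thesis
        by (simp add: q_def c_def f.add f.scaleR algebra_simps)
    qed
    have "q (z + (- c / s) *\<^sub>R h) = q z + (c / s)\<^sup>2 * (norm h)\<^sup>2 - 2 * (c / s) * c"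
      unfolding expand by (simp add: power2_eq_square)
    also have "(norm h)\<^sup>2 = s - 1" by (simp add: s_def)
    also have "q z + (c / s)\<^sup>2 * (s - 1) - 2 * (c / s) * c = q z - c\<^sup>2 / s - (c / s)\<^sup>2"
      using s by (simp add: power2_eq_square field_simps)
    finally have "q (z + (- c / s) *\<^sub>R h) < q z"
      using s c by (simp add: add_pos_pos diff_less_eq less_add_same_cancel1)
    with min[of "z + (- c / s) *\<^sub>R h"] show False by simp
  qed
  with that show thesis by blast
qed

text \<open>
  The constant \<open>adjoint\<close> is a Hilbert choice, so its defining identity has to be earned by exhibiting
  some adjoint: \<open>K\<^sup>* y\<close> represents the functional \<open>x \<mapsto> \<langle>K x, y\<rangle>\<close>.
\<close>

lemma adjoint_blinfun:
  fixes K :: "'a::{real_inner,complete_space} \<Rightarrow>\<^sub>L 'b::real_inner"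
  shows "blinfun_apply K x \<bullet> y = x \<bullet> adjoint (blinfun_apply K) y"
proof -
  have "\<exists>z. \<forall>x. K x \<bullet> y = x \<bullet> z" for y
  proof -
    have "bounded_linear (\<lambda>x. K x \<bullet> y)"
      by (intro bounded_linear_intros)
    then obtain z where "\<And>x. K x \<bullet> y = x \<bullet> z"
      using riesz_representation by blast
    then show ?thesis by blast
  qed
  then have "\<exists>f'. \<forall>x y. K x \<bullet> y = x \<bullet> f' y" by metis
  then have "\<forall>x y. K x \<bullet> y = x \<bullet> adjoint (blinfun_apply K) y"
    unfolding adjoint_def by (rule someI_ex)
  then show ?thesis by blast
qed

section \<open>Gradients and the descent lemma\<close>

lemma grad_eqI:
  assumes "GDERIV f x :> g"
  shows "grad f x = g"
  unfolding grad_def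
proof (rule the_equality)
  fix g' assume "GDERIV f x :> g'"
  then have "(\<lambda>h. h \<bullet> g') = (\<lambda>h. h \<bullet> g)"
    using assms unfolding gderiv_def by (rule has_derivative_unique)
  then show "g' = g"
    by (metis vector_eq_ldot)
qed (fact assms)

lemma GDERIV_grad:
  fixes f :: "'a::{real_inner,complete_space} \<Rightarrow> real"
  assumes "f differentiable at x"
  shows "GDERIV f x :> grad f x"
proof -
  obtain f' where f': "(f has_derivative f') (at x)"
    using assms by (auto simp: differentiable_def)
  obtain z where "\<And>h. f' h = h \<bullet> z"
    using riesz_representation[OF has_derivative_bounded_linear[OF f']] by blast
  then have "f' = (\<lambda>h. h \<bullet> z)" by blast
  with f' have "GDERIV f x :> z" by (simp add: gderiv_def)
  then show ?thesis using grad_eqI by metis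
qed

lemma Ebar_apply: "Ebar E p = E (fst p)"
  by (simp add: Ebar_def case_prod_unfold)

lemma grad_Ebar:
  fixes E :: "'a::{real_inner,complete_space} \<Rightarrow> real" and p :: "'a \<times> 'b::real_inner"
  assumes "E differentiable at (fst p)"
  shows "grad (Ebar E) p = (grad E (fst p), 0)"
proof (rule grad_eqI)
  have "((\<lambda>w. E (fst w)) has_derivative (\<lambda>h. fst h \<bullet> grad E (fst p))) (at p)"
    using GDERIV_grad[OF assms] unfolding gderiv_def
    by (rule has_derivative_compose[OF has_derivative_fst[OF has_derivative_ident]])
  then show "GDERIV (Ebar E) p :> (grad E (fst p), 0)"
    by (simp add: gderiv_def Ebar_apply[abs_def] inner_prod_def)
qed

lemma DERIV_along_line:
  fixes f :: "'a::{real_inner,complete_space} \<Rightarrow> real"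
  assumes "f differentiable at (x + t *\<^sub>R h)"
  shows "((\<lambda>t. f (x + t *\<^sub>R h)) has_real_derivative grad f (x + t *\<^sub>R h) \<bullet> h) (at t)"
proof -
  have "((\<lambda>t. x + t *\<^sub>R h) has_derivative (\<lambda>s. s *\<^sub>R h)) (at t)"
    by (auto intro!: derivative_eq_intros)
  then have "((\<lambda>t. f (x + t *\<^sub>R h)) has_derivative (\<lambda>s. (s *\<^sub>R h) \<bullet> grad f (x + t *\<^sub>R h))) (at t)"
    using GDERIV_grad[OF assms] unfolding gderiv_def by (rule has_derivative_compose)
  then show ?thesis
    by (simp add: has_field_derivative_def inner_commute mult.commute[of _ "_ \<bullet> _"])
qed

text \<open>
  Along the segment from \<open>x\<close> to \<open>x + h\<close> the error of the linearisation has derivative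
  \<open>\<langle>\<nabla>f(x + t h) - \<nabla>f(x), h\<rangle> \<le> L t \<parallel>h\<parallel>\<^sup>2\<close>, so subtracting \<open>L t\<^sup>2/2 \<cdot> \<parallel>h\<parallel>\<^sup>2\<close> makes it nonincreasing.
\<close>

lemma lipschitz_gradient_descent:
  fixes f :: "'a::{real_inner,complete_space} \<Rightarrow> real"
  assumes diff: "f differentiable_on UNIV" and lip: "L-lipschitz_on UNIV (grad f)"
  shows "f (x + h) \<le> f x + grad f x \<bullet> h + L / 2 * (norm h)\<^sup>2"
proof -
  define \<phi> where "\<phi> t = f (x + t *\<^sub>R h) - t * (grad f x \<bullet> h) - L * t\<^sup>2 / 2 * (norm h)\<^sup>2" for t
  have "\<phi> 1 \<le> \<phi> 0"
  proof (rule DERIV_nonpos_imp_nonincreasing[where f = \<phi>])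
    fix t :: real
    assume t: "0 \<le> t" "t \<le> 1"
    have at: "f differentiable at (x + t *\<^sub>R h)"
      using diff by (simp add: differentiable_on_def)
    have D: "(\<phi> has_real_derivative
        grad f (x + t *\<^sub>R h) \<bullet> h - grad f x \<bullet> h - L * t * (norm h)\<^sup>2) (at t)"
      unfolding \<phi>_def
      by (auto intro!: derivative_eq_intros DERIV_along_line[OF at])
    have "grad f (x + t *\<^sub>R h) \<bullet> h - grad f x \<bullet> h = (grad f (x + t *\<^sub>R h) - grad f x) \<bullet> h"
      by (simp add: inner_diff_left)
    also have "\<dots> \<le> norm (grad f (x + t *\<^sub>R h) - grad f x) * norm h"
      by (rule norm_cauchy_schwarz)
    also have "\<dots> \<le> (L * (t * norm h)) * norm h"
      using lipschitz_onD[OF lip, of "x + t *\<^sub>R h" x] t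
      by (intro mult_right_mono) (auto simp: dist_norm)
    finally have "grad f (x + t *\<^sub>R h) \<bullet> h - grad f x \<bullet> h - L * t * (norm h)\<^sup>2 \<le> 0"
      by (simp add: power2_eq_square algebra_simps)
    with D show "\<exists>y. (\<phi> has_real_derivative y) (at t) \<and> y \<le> 0" by blast
  qed simp
  then show ?thesis by (simp add: \<phi>_def)
qed

section \<open>The norm of \<open>M + \<Lambda>\<close>\<close>

text \<open>
  After Cauchy--Schwarz the quadratic form is bounded below by a quadratic polynomial in the numbers
  \<open>\<parallel>x\<parallel>\<close> and \<open>\<parallel>y\<parallel>\<close>; completing the square in \<open>\<parallel>x\<parallel>\<close> leaves a remainder whose sign is decided by the
  step length condition.
\<close>

lemma op_M_nonneg:
  fixes K :: "'x::{real_inner,complete_space} \<Rightarrow>\<^sub>L 'y::real_inner"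
  assumes "\<tau> > 0" "\<sigma> > 0" and step: "\<tau> * \<sigma> * (norm K)\<^sup>2 \<le> 1"
  shows "op_M \<tau> \<sigma> K w \<bullet> w \<ge> 0"
proof -
  obtain x y where w: "w = (x, y)" by (cases w)
  have "op_M \<tau> \<sigma> K w \<bullet> w = (norm x)\<^sup>2 / \<tau> - 2 * (K x \<bullet> y) + (norm y)\<^sup>2 / \<sigma>"
    using adjoint_blinfun[of K x y]
    by (simp add: w op_M_def inner_add inner_diff power2_norm_eq_inner inner_commute)
  moreover have "K x \<bullet> y \<le> norm K * norm x * norm y"
    by (meson norm_blinfun norm_cauchy_schwarz mult_right_mono norm_ge_zero order_trans)
  moreover have "(norm x)\<^sup>2 / \<tau> - 2 * (norm K * norm x * norm y) + (norm y)\<^sup>2 / \<sigma>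
      = (norm x - \<tau> * norm K * norm y)\<^sup>2 / \<tau> + (1 - \<tau> * \<sigma> * (norm K)\<^sup>2) / \<sigma> * (norm y)\<^sup>2"
    using assms by (simp add: power2_eq_square field_simps)
  moreover have "\<dots> \<ge> 0"
    using assms by simp
  ultimately show ?thesis by linarith
qed

lemma op_norm_M_plus_Lambda:
  fixes K :: "'x::{real_inner,complete_space} \<Rightarrow>\<^sub>L 'y::real_inner"
  assumes "\<tau> > 0" "\<sigma> > 0" "\<tau> * \<sigma> * (norm K)\<^sup>2 \<le> 1" "L \<ge> 0"
  shows "(op_norm (\<lambda>w. op_M \<tau> \<sigma> K w + op_Lambda L w) w)\<^sup>2
    = (op_norm (op_M \<tau> \<sigma> K) w)\<^sup>2 + L * (norm (fst w))\<^sup>2"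
proof -
  have "op_Lambda L w \<bullet> w = L * (norm (fst w))\<^sup>2"
    by (cases w) (simp add: op_Lambda_def power2_norm_eq_inner)
  then show ?thesis
    using op_M_nonneg[OF assms(1-3), of w] \<open>L \<ge> 0\<close>
    by (simp add: op_norm_def inner_add_left)
qed

section \<open>Directional derivatives in the extended reals\<close>

text \<open>
  Both implications between the two limits hold, so even an unspecified value of a nonexistent
  limit is preserved.
\<close>

lemma Lim_add_null_ereal:
  fixes a :: "'a \<Rightarrow> ereal" and h :: "'a \<Rightarrow> real"
  assumes "(h \<longlongrightarrow> 0) A"
  shows "Lim A (\<lambda>t. a t + ereal (h t)) = Lim A a"
proof -
  have perturb: "((\<lambda>t. b t + ereal (g t)) \<longlongrightarrow> l) A"
    if "(b \<longlongrightarrow> l) A" "(g \<longlongrightarrow> 0) A" for b :: "'a \<Rightarrow> ereal" and g l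
    using tendsto_add_ereal_general1[of 0 b l A "\<lambda>t. ereal (g t)"] that by (simp add: zero_ereal_def)
  have cancel: "(\<lambda>t. (a t + ereal (h t)) + ereal (- h t)) = a"
  proof
    fix t show "(a t + ereal (h t)) + ereal (- h t) = a t" by (cases "a t") auto
  qed
  have "((\<lambda>t. a t + ereal (h t)) \<longlongrightarrow> l) A \<longleftrightarrow> (a \<longlongrightarrow> l) A" for l
  proof
    assume "((\<lambda>t. a t + ereal (h t)) \<longlongrightarrow> l) A"
    from perturb[OF this, of "\<lambda>t. - h t"] show "(a \<longlongrightarrow> l) A"
      using tendsto_minus[OF assms] by (simp add: cancel)
  qed (use perturb assms in blast)
  then show ?thesis by (simp add: t2_space_class.Lim_def)
qed

text \<open>
  The difference quotients of the two functions differ by that of \<open>E\<close> minus its limit. Finiteness at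
  the base point is what allows the common nonsmooth part to be handled by extended real arithmetic.
\<close>

lemma dir_deriv_Phi_eq_Psi:
  fixes E :: "'x::{real_inner,complete_space} \<Rightarrow> real" and G :: "'y::real_inner \<Rightarrow> ereal"
  assumes diff: "E differentiable at (fst p)" and fin: "\<bar>Gbar F G p\<bar> \<noteq> \<infinity>"
  shows "dir_deriv (Phi F G E K p) p d = dir_deriv (Psi F G E K p) p d"
proof -
  define h where "h t = (E (fst p + t *\<^sub>R fst d) - E (fst p)) / t - grad E (fst p) \<bullet> fst d" for t
  obtain r where r: "Gbar F G p = ereal r" using fin by auto
  have "((\<lambda>t. E (fst p + t *\<^sub>R fst d)) has_real_derivative grad E (fst p) \<bullet> fst d) (at 0)"
    using DERIV_along_line[of E "fst p" 0 "fst d"] diff by simp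
  then have "((\<lambda>t. (E (fst p + t *\<^sub>R fst d) - E (fst p)) / t) \<longlongrightarrow> grad E (fst p) \<bullet> fst d) (at 0)"
    by (simp add: has_field_derivative_iff)
  then have "(h \<longlongrightarrow> 0) (at 0)"
    unfolding h_def using LIM_zero by blast
  then have h: "(h \<longlongrightarrow> 0) (at_right 0)"
    by (rule filterlim_mono) (auto simp: at_le)
  have quot: "(Phi F G E K p (p + t *\<^sub>R d) - Phi F G E K p p) / ereal t
      = (Psi F G E K p (p + t *\<^sub>R d) - Psi F G E K p p) / ereal t + ereal (h t)"
    if "t > 0" for t
    using that
    by (cases "Gbar F G (p + t *\<^sub>R d)")
      (simp_all add: Phi_def Psi_def r h_def grad_Ebar[OF diff] Ebar_apply inner_prod_def field_simps)
  have "\<forall>\<^sub>F t in at_right 0. (Phi F G E K p (p + t *\<^sub>R d) - Phi F G E K p p) / ereal t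
      = (Psi F G E K p (p + t *\<^sub>R d) - Psi F G E K p p) / ereal t + ereal (h t)"
    using eventually_at_right_less[of "0::real"] by eventually_elim (rule quot)
  then show ?thesis
    unfolding dir_deriv_def by (simp only: Lim_cong[OF _ refl] Lim_add_null_ereal[OF h])
qed

section \<open>Transferring the descent inequality\<close>

lemma Gbar_neq_MInfty:
  assumes "proper F" "proper G"
  shows "Gbar F G p \<noteq> -\<infinity>"
proof -
  obtain a where "G a \<noteq> \<infinity>" "G a \<noteq> -\<infinity>"
    using \<open>proper G\<close> by (auto simp: proper_def)
  then obtain r where "G a = ereal r" by (cases "G a") auto
  then have "ereal (y \<bullet> a - r) \<le> fenchel_conjugate G y" for y
    unfolding fenchel_conjugate_def by (intro SUP_upper2[of a]) auto
  then have "fenchel_conjugate G y \<noteq> -\<infinity>" for y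
    by (metis MInfty_neq_ereal(1) ereal_infty_less_eq(2))
  then show ?thesis
    using \<open>proper F\<close> by (auto simp: Gbar_def proper_def split: prod.split)
qed

lemma Phi_le_Psi_plus_quadratic:
  fixes E :: "'x::{real_inner,complete_space} \<Rightarrow> real" and G :: "'y::real_inner \<Rightarrow> ereal"
  assumes diff: "E differentiable_on UNIV" and lip: "L-lipschitz_on UNIV (grad E)"
  shows "Phi F G E K p (p + w) \<le> Psi F G E K p (p + w) + ereal (L / 2 * (norm (fst w))\<^sup>2)"
proof -
  have "E differentiable at (fst p)"
    using diff by (simp add: differentiable_on_def)
  moreover have "E (fst p + fst w) \<le> E (fst p) + grad E (fst p) \<bullet> fst w + L / 2 * (norm (fst w))\<^sup>2"
    by (rule lipschitz_gradient_descent[OF diff lip])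
  ultimately show ?thesis
    by (cases "Gbar F G (p + w)")
      (simp_all add: Phi_def Psi_def grad_Ebar Ebar_apply inner_prod_def)
qed

theorem theorem5p6:
  fixes F :: "'x::{real_inner,complete_space} \<Rightarrow> ereal"
    and E :: "'x \<Rightarrow> real"
    and G :: "'y::{real_inner,complete_space} \<Rightarrow> ereal"
    and K :: "'x \<Rightarrow>\<^sub>L 'y"
    and L \<tau> \<sigma> :: real
    and u up d :: "'x \<times> 'y"
    and P :: "'x \<Rightarrow>\<^sub>L 'xh::{real_inner,complete_space}"
    and D :: "'y \<Rightarrow>\<^sub>L 'yh::{real_inner,complete_space}"
    and FH :: "'xh \<Rightarrow> ereal"
    and EH :: "'xh \<Rightarrow> real"
    and GH :: "'yh \<Rightarrow> ereal"
    and KH :: "'xh \<Rightarrow>\<^sub>L 'yh"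
    and LH \<tau>H \<sigma>H :: real
    and v :: "nat \<Rightarrow> 'xh \<times> 'yh"
    and s vt :: "'xh \<times> 'yh"
    and m :: nat
    and vth :: real
    and \<epsilon> \<rho> \<kappa> \<theta> :: real
  assumes "proper_convex_lsc F"
    and "proper_convex_lsc (\<lambda>x. ereal (E x))"
    and "proper_convex_lsc G"
    and "E differentiable_on UNIV"
    and "L-lipschitz_on UNIV (grad E)"
    and "\<tau> > 0" and "\<sigma> > 0"
    and "\<tau> * L + \<tau> * \<sigma> * (norm K)\<^sup>2 < 1"
    and "up = pre_iterate \<tau> \<sigma> F G E K u"
    and "proper_convex_lsc FH"
    and "proper_convex_lsc (\<lambda>x. ereal (EH x))"
    and "proper_convex_lsc GH"
    and "EH differentiable_on UNIV"
    and "LH-lipschitz_on UNIV (grad EH)"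
    and "\<tau>H > 0" and "\<sigma>H > 0"
    and "\<tau>H * LH + \<tau>H * \<sigma>H * (norm KH)\<^sup>2 < 1"
    and "v 0 = restriction P D up"
    and "restriction P D ` subdifferential (Gbar F G) up \<subseteq> subdifferential (Gbar FH GH) (v 0)"
    and "s = restriction P D (grad (Ebar E) up + op_Xi K up) - grad (Ebar EH) (v 0)"
    and "m \<ge> 1"
    and "vth \<in> {0, 1}"
    and "\<And>j. j < m \<Longrightarrow>
           0 \<in> (\<lambda>g. g + op_Xi KH (v (Suc j) - ((1 - vth) *\<^sub>R v j + vth *\<^sub>R v 0))
                     + grad (Ebar EH) (v j) + s
                     + op_M \<tau>H \<sigma>H KH (v (Suc j) - v j))
               ` subdifferential (Gbar FH GH) (v (Suc j))"
    and "vt = (if vth = 1 then (1 / real m) *\<^sub>R (\<Sum>j<m. v (Suc j)) else v m)"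
    and "d = adjoint (restriction P D) (vt - v 0)"
    and "\<epsilon> > 0" and "\<rho> > 0" and "0 < \<kappa>" and "\<kappa> < 1" and "\<theta> \<ge> 0"
    and "Psi F G E K up (up + \<theta> *\<^sub>R d)
           + ereal (1 / 2 * (op_norm (\<lambda>w. op_M \<tau> \<sigma> K w + op_Lambda L w) (\<theta> *\<^sub>R d))\<^sup>2)
           + ereal (1 / (2 * \<epsilon>) * (op_norm (op_W \<tau> \<sigma> K) (\<theta> *\<^sub>R d))\<^sup>2)
         \<le> Psi F G E K up up + ereal (\<kappa> * \<theta>) * dir_deriv (Psi F G E K up) up d + ereal (\<rho> / 2)"
  shows "Phi F G E K up (up + \<theta> *\<^sub>R d)
           + ereal (1 / 2 * (op_norm (op_M \<tau> \<sigma> K) (\<theta> *\<^sub>R d))\<^sup>2)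
           + ereal (1 / (2 * \<epsilon>) * (op_norm (op_W \<tau> \<sigma> K) (\<theta> *\<^sub>R d))\<^sup>2)
         \<le> Phi F G E K up up + ereal (\<kappa> * \<theta>) * dir_deriv (Phi F G E K up) up d + ereal (\<rho> / 2)"
proof (cases "Gbar F G up = \<infinity>")
  case True
  \<comment> \<open>the right-hand side is \<open>\<infinity>\<close>, also for an infinite derivative term: \<open>\<infinity> + -\<infinity> = \<infinity>\<close> in \<open>ereal\<close>\<close>
  then show ?thesis by (simp add: Phi_def)
next
  case False
  define w where "w = \<theta> *\<^sub>R d"
  have "proper F" "proper G"
    using assms(1,3) by (simp_all add: proper_convex_lsc_def)
  with False have fin: "\<bar>Gbar F G up\<bar> \<noteq> \<infinity>"
    using Gbar_neq_MInfty[of F G up] by auto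
  have "E differentiable at (fst up)"
    using assms(4) by (simp add: differentiable_on_def)
  then have dd: "dir_deriv (Phi F G E K up) up d = dir_deriv (Psi F G E K up) up d"
    using fin by (rule dir_deriv_Phi_eq_Psi)
  have base: "Phi F G E K up up = Psi F G E K up up"
    by (simp add: Phi_def Psi_def)
  have "L \<ge> 0"
    using assms(5) by (rule lipschitz_on_nonneg)
  then have "\<tau> * L \<ge> 0" using \<open>\<tau> > 0\<close> by simp
  then have "\<tau> * \<sigma> * (norm K)\<^sup>2 \<le> 1" using assms(8) by linarith
  then have split: "1 / 2 * (op_norm (\<lambda>w. op_M \<tau> \<sigma> K w + op_Lambda L w) w)\<^sup>2
      = L / 2 * (norm (fst w))\<^sup>2 + 1 / 2 * (op_norm (op_M \<tau> \<sigma> K) w)\<^sup>2"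
    using op_norm_M_plus_Lambda[OF \<open>\<tau> > 0\<close> \<open>\<sigma> > 0\<close> _ \<open>L \<ge> 0\<close>, of K w] by simp
  have "Phi F G E K up (up + w) + ereal (1 / 2 * (op_norm (op_M \<tau> \<sigma> K) w)\<^sup>2)
        + ereal (1 / (2 * \<epsilon>) * (op_norm (op_W \<tau> \<sigma> K) w)\<^sup>2)
      \<le> Psi F G E K up (up + w) + ereal (L / 2 * (norm (fst w))\<^sup>2)
        + ereal (1 / 2 * (op_norm (op_M \<tau> \<sigma> K) w)\<^sup>2)
        + ereal (1 / (2 * \<epsilon>) * (op_norm (op_W \<tau> \<sigma> K) w)\<^sup>2)"
    by (intro add_right_mono Phi_le_Psi_plus_quadratic assms)
  also have "\<dots> = Psi F G E K up (up + w)
        + ereal (1 / 2 * (op_norm (\<lambda>w. op_M \<tau> \<sigma> K w + op_Lambda L w) w)\<^sup>2)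
        + ereal (1 / (2 * \<epsilon>) * (op_norm (op_W \<tau> \<sigma> K) w)\<^sup>2)"
    unfolding split by (simp add: add.assoc flip: plus_ereal.simps(1))
  also have "\<dots> \<le> Psi F G E K up up
        + ereal (\<kappa> * \<theta>) * dir_deriv (Psi F G E K up) up d + ereal (\<rho> / 2)"
    unfolding w_def by (rule assms(31))
  finally show ?thesis
    by (simp only: dd base w_def)
qed

end
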